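(* Let $(x_k)_{k\ge0}$ be generated by Anderson acceleration AA(1) from an initial guess $x_0\in\mathbb{R}^n$, applied to the linear fixed-point function $q(x)=Mx+b$, with residuals $r_k=x_k-q(x_k)$. Let $k>1$ with $r_{k-1}\neq0$ and $r_k\ne0$. Define $y_k:=\|r_k\|/\|r_{k-1}\|>0$ and let $\phi_k\in[0,\pi]$ be the angle between $r_k$ and $r_{k-1}$, i.e. $r_k^Tr_{k-1}=\|r_{k-1}\|\,\|r_k\|\cos\phi_k$. Let $\sigma_{\min}(M)$ and $\sigma_{\max}(M)$ denote the minimum and maximum singular values of $M$. Then $$ \sqrt{\mathcal{B}(\phi_k,y_k)}\,\sigma_{\min}(M)\le\frac{\|r_{k+1}\|}{\|r_k\|}\le\sqrt{\mathcal{B}(\phi_k,y_k)}\,\sigma_{\max}(M)\quad\text{if } r_k\neq r_{k-1}, $$ $$ \sigma_{\min}(M)\le\frac{\|r_{k+1}\|}{\|r_k\|}\le\sigma_{\max}(M)\quad\text{if } r_k=r_{k-1}, $$ where the function $\mathcal{B}:\big([0,\pi]\times(0,\infty)\big)\setminus\{(0,1)\}\to[0,1]$ is given by $$ \mathcal{B}(\phi,y)=\frac{\sin^2\phi}{y^2-2y\cos\phi+1}. $$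
   Context: Setting: $M\in\mathbb{R}^{n\times n}$, $b\in\mathbb{R}^n$, $q(x)=Mx+b$, $A=I-M$ is nonsingular and $M\neq 0$. $\|\cdot\|$ is the 2-norm. The residual is $r(x)=x-q(x)=Ax-b$ and $r_k=r(x_k)$. AA(1): given $x_0\in\mathbb{R}^n$, set $x_1=q(x_0)$ and for $k\ge1$ $$x_{k+1}=(1+\beta_k)q(x_k)-\beta_kq(x_{k-1}),\qquad \beta_k=\frac{-r_k^T(r_k-r_{k-1})}{\|r_k-r_{k-1}\|^2}\ \text{ if } r_k\ne r_{k-1},$$ and $\beta_k=0$ if $r_k=r_{k-1}$. *)

theory Defs
  imports "HOL-Analysis.Analysis"
begin

definition residual :: "('a \<Rightarrow> 'a) \<Rightarrow> 'a \<Rightarrow> 'a::real_inner"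
  where "residual q x = x - q x"

text \<open>The coefficient \<open>\<beta>\<^sub>k\<close> as a function of the current iterate \<open>x = x\<^sub>k\<close> and the
  previous iterate \<open>x' = x\<^sub>k\<^sub>-\<^sub>1\<close>.\<close>

definition aa1_beta :: "('a \<Rightarrow> 'a) \<Rightarrow> 'a \<Rightarrow> 'a::real_inner \<Rightarrow> real"
  where "aa1_beta q x x' =
    (if residual q x \<noteq> residual q x'
     then - (residual q x \<bullet> (residual q x - residual q x')) / (norm (residual q x - residual q x'))\<^sup>2
     else 0)"

fun aa1 :: "('a \<Rightarrow> 'a) \<Rightarrow> 'a \<Rightarrow> nat \<Rightarrow> 'a::real_inner"
  where
    "aa1 q x0 0 = x0"
  | "aa1 q x0 (Suc 0) = q x0"
  | "aa1 q x0 (Suc (Suc k)) =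
       (1 + aa1_beta q (aa1 q x0 (Suc k)) (aa1 q x0 k)) *\<^sub>R q (aa1 q x0 (Suc k))
       - aa1_beta q (aa1 q x0 (Suc k)) (aa1 q x0 k) *\<^sub>R q (aa1 q x0 k)"

definition eigenvalues :: "real^'n^'n \<Rightarrow> real set"
  where "eigenvalues A = {c. \<exists>v. v \<noteq> 0 \<and> A *v v = c *\<^sub>R v}"

definition singular_values :: "real^'n^'n \<Rightarrow> real set"
  where "singular_values M = sqrt ` eigenvalues (transpose M ** M)"

definition sigma_min :: "real^'n^'n \<Rightarrow> real"
  where "sigma_min M = Min (singular_values M)"

definition sigma_max :: "real^'n^'n \<Rightarrow> real"
  where "sigma_max M = Max (singular_values M)"

definition aa1_B :: "real \<Rightarrow> real \<Rightarrow> real"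
  where "aa1_B \<phi> y = (sin \<phi>)\<^sup>2 / (y\<^sup>2 - 2 * y * cos \<phi> + 1)"

definition aa1_B_domain :: "(real \<times> real) set"
  where "aa1_B_domain = ({0..pi} \<times> {0<..}) - {(0, 1)}"

text \<open>The denominator of \<open>aa1_B\<close> does not vanish on the domain, so the HOL convention for
  division by zero plays no role there.\<close>

lemma aa1_B_denominator_pos:
  assumes "(\<phi>, y) \<in> aa1_B_domain"
  shows "0 < y\<^sup>2 - 2 * y * cos \<phi> + 1"
proof (rule ccontr)
  have eq: "y\<^sup>2 - 2 * y * cos \<phi> + 1 = (y - cos \<phi>)\<^sup>2 + (sin \<phi>)\<^sup>2"
    using sin_cos_squared_add[of \<phi>] by (simp add: power2_eq_square algebra_simps)
  assume "\<not> 0 < y\<^sup>2 - 2 * y * cos \<phi> + 1"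
  hence "(y - cos \<phi>)\<^sup>2 + (sin \<phi>)\<^sup>2 \<le> 0"
    using eq by simp
  hence "y = cos \<phi>" "sin \<phi> = 0"
    by (simp_all add: sum_power2_le_zero_iff)
  moreover have "0 \<le> \<phi>" "\<phi> \<le> pi" "0 < y" "(\<phi>, y) \<noteq> (0, 1)"
    using assms by (auto simp: aa1_B_domain_def)
  ultimately have "\<phi> = 0 \<or> \<phi> = pi"
    using sin_gt_zero[of \<phi>] by fastforce
  thus False
    using \<open>y = cos \<phi>\<close> \<open>0 < y\<close> \<open>(\<phi>, y) \<noteq> (0, 1)\<close> by auto
qed

end

theory Submission
  imports Defs
begin

text \<open>
  For affine \<open>q\<close> one has \<open>q z - q (q z) = M (z - q z)\<close>: one step of the plain iteration
  multiplies the residual by \<open>M\<close>. The residual is itself affine, so it passes through the affine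
  combination that defines the Anderson step, and
  \<open>r\<^sub>k\<^sub>+\<^sub>1 = M p\<close> with \<open>p = r\<^sub>k + \<beta>\<^sub>k (r\<^sub>k - r\<^sub>k\<^sub>-\<^sub>1)\<close> (\<open>residual_aa1_step\<close>).

  The coefficient \<open>\<beta>\<^sub>k\<close> is the least-squares one, hence \<open>p\<close> is the component of \<open>r\<^sub>k\<close>
  orthogonal to \<open>r\<^sub>k - r\<^sub>k\<^sub>-\<^sub>1\<close>. Its length is the distance from \<open>0\<close> to the line through
  \<open>r\<^sub>k\<close> and \<open>r\<^sub>k\<^sub>-\<^sub>1\<close>, i.e. an altitude of the triangle with vertices \<open>0\<close>, \<open>r\<^sub>k\<close>,
  \<open>r\<^sub>k\<^sub>-\<^sub>1\<close>. Twice the area of that triangle, divided by the side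
  \<open>\<parallel>r\<^sub>k - r\<^sub>k\<^sub>-\<^sub>1\<parallel>\<close> given by the law of cosines, shows that \<open>\<parallel>p\<parallel> / \<parallel>r\<^sub>k\<parallel>\<close> is the square root of
  \<open>aa1_B\<close> (\<open>norm_rejection_eq_aa1_B\<close>). If the two residuals coincide, the line degenerates to
  a point, \<open>\<beta>\<^sub>k = 0\<close> and \<open>p = r\<^sub>k\<close>.

  What remains is \<open>\<sigma>\<^sub>m\<^sub>i\<^sub>n \<parallel>p\<parallel> \<le> \<parallel>M p\<parallel> \<le> \<sigma>\<^sub>m\<^sub>a\<^sub>x \<parallel>p\<parallel>\<close>. As the singular values are
  defined through the eigenvalues of \<open>M\<^sup>T M\<close>, this requires a piece of the spectral theorem: the
  extrema of \<open>\<parallel>M v\<parallel>\<close> over the unit sphere are attained, at eigenvectors of \<open>M\<^sup>T M\<close>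
  (\<open>gram_eigenvector_if_extremal\<close>), and there are only finitely many eigenvalues, so that \<open>Min\<close>
  and \<open>Max\<close> bound the square roots of the extremal ones.
\<close>

section \<open>Extremal singular values and the norm of a matrix-vector product\<close>

lemma inner_gram_matrix:
  fixes M :: "real^'n^'n"
  shows "v \<bullet> ((transpose M ** M) *v w) = (M *v v) \<bullet> (M *v w)"
  by (metis dot_lmul_matrix inner_commute matrix_vector_mul_assoc transpose_matrix_vector
      transpose_transpose)

text \<open>Eigenvectors of the symmetric matrix \<open>M\<^sup>T M\<close> for distinct eigenvalues are orthogonal, and
  an orthogonal family of nonzero vectors is linearly independent.\<close>

lemma finite_eigenvalues_gram:
  fixes M :: "real^'n^'n"
  shows "finite (eigenvalues (transpose M ** M))"
proof -
  let ?S = "transpose M ** M"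
  let ?E = "eigenvalues ?S"
  have "\<forall>c\<in>?E. \<exists>v. v \<noteq> 0 \<and> ?S *v v = c *\<^sub>R v"
    by (auto simp: eigenvalues_def)
  then obtain f where f: "\<And>c. c \<in> ?E \<Longrightarrow> f c \<noteq> 0 \<and> ?S *v f c = c *\<^sub>R f c"
    by metis
  have orth: "f c \<bullet> f d = 0" if "c \<in> ?E" "d \<in> ?E" "c \<noteq> d" for c d
  proof -
    have "f c \<bullet> (?S *v f d) = f d \<bullet> (?S *v f c)"
      by (simp add: inner_gram_matrix inner_commute)
    hence "d * (f c \<bullet> f d) = c * (f c \<bullet> f d)"
      using f that by (simp add: inner_commute)
    thus ?thesis using that(3) by simp
  qed
  have inj: "inj_on f ?E"
    by (rule inj_onI) (metis f inner_eq_zero_iff orth)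
  have "pairwise orthogonal (f ` ?E)"
    using orth by (auto simp: pairwise_def orthogonal_def)
  moreover have "0 \<notin> f ` ?E" using f by auto
  ultimately have "finite (f ` ?E)"
    using pairwise_orthogonal_independent independent_bound by blast
  thus ?thesis using inj finite_image_iff by blast
qed

text \<open>The quadratic form \<open>v \<bullet> T v\<close> has a minimum at \<open>u\<close>, so its derivative \<open>2 T u\<close> vanishes
  there.\<close>

lemma psd_null_vector:
  fixes T :: "'a::real_inner \<Rightarrow> 'a"
  assumes lin: "linear T"
    and symm: "\<And>v w. v \<bullet> T w = w \<bullet> T v"
    and psd: "\<And>v. 0 \<le> v \<bullet> T v"
    and null: "u \<bullet> T u = 0"
  shows "T u = 0"
proof (rule ccontr)
  assume nz: "T u \<noteq> 0"
  let ?w = "T u"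
  define a c where "a = ?w \<bullet> ?w" and "c = ?w \<bullet> T ?w"
  have a: "a > 0" using nz by (simp add: a_def)
  have c: "c \<ge> 0" unfolding c_def by (rule psd)
  have expand: "(u - t *\<^sub>R ?w) \<bullet> T (u - t *\<^sub>R ?w) = t * (t * c - 2 * a)" for t
    using symm[of u ?w] null
    by (simp add: linear_diff[OF lin] linear_scale[OF lin] inner_diff_left inner_diff_right
        a_def c_def algebra_simps)
  \<comment> \<open>A step against the gradient, short enough for the linear term to dominate the quadratic one.\<close>
  define t where "t = a / (c + 1)"
  have "t > 0" and "t * c < 2 * a"
    using a c by (auto simp: t_def field_simps intro: add_nonneg_pos)
  hence "t * (t * c - 2 * a) < 0"
    by (simp add: mult_pos_neg)
  thus False using psd[of "u - t *\<^sub>R ?w"] expand[of t] by simp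
qed

text \<open>The sign \<open>s\<close> is \<open>1\<close> when \<open>m\<close> is the minimum of \<open>\<parallel>M v\<parallel>\<^sup>2 / \<parallel>v\<parallel>\<^sup>2\<close> and \<open>-1\<close> when it is the
  maximum. In both cases \<open>s (M\<^sup>T M - m I)\<close> is positive semidefinite and its quadratic form vanishes
  at \<open>u\<close>.\<close>

lemma gram_eigenvector_if_extremal:
  fixes M :: "real^'n^'n"
  assumes s: "s \<noteq> 0"
    and ext: "\<And>v. 0 \<le> s * ((norm (M *v v))\<^sup>2 - m * (norm v)\<^sup>2)"
    and u: "u \<noteq> 0" "(norm (M *v u))\<^sup>2 = m * (norm u)\<^sup>2"
  shows "m \<in> eigenvalues (transpose M ** M)"
proof -
  let ?T = "\<lambda>v. s *\<^sub>R ((transpose M ** M) *v v - m *\<^sub>R v)"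
  have form: "v \<bullet> ?T w = s * ((M *v v) \<bullet> (M *v w) - m * (v \<bullet> w))" for v w
    by (simp add: inner_diff_right inner_gram_matrix)
  have "?T u = 0"
  proof (rule psd_null_vector[where T = ?T])
    show "linear ?T"
      by (rule linearI) (simp_all add: matrix_vector_right_distrib algebra_simps
          matrix_vector_mult_scaleR)
    show "v \<bullet> ?T w = w \<bullet> ?T v" for v w
      unfolding form by (simp add: inner_commute)
    show "0 \<le> v \<bullet> ?T v" for v
      unfolding form using ext[of v] by (simp add: power2_norm_eq_inner)
    show "u \<bullet> ?T u = 0"
      unfolding form using u(2) by (simp add: power2_norm_eq_inner)
  qed
  thus ?thesis using s u(1) by (auto simp: eigenvalues_def)
qed

lemma continuous_on_norm_matrix_vector:
  fixes M :: "real^'n^'n"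
  shows "continuous_on S (\<lambda>w. norm (M *v w))"
  by (intro continuous_on_norm linear_continuous_on matrix_vector_mul_bounded_linear)

lemma norm_matrix_vector_normalize:
  fixes M :: "real^'n^'n"
  shows "norm (M *v v) = norm (M *v sgn v) * norm v"
  by (cases "v = 0") (simp_all add: sgn_div_norm matrix_vector_mult_scaleR)

lemma sigma_min_mult_norm_le:
  fixes M :: "real^'n^'n"
  shows "sigma_min M * norm v \<le> norm (M *v v)"
proof -
  obtain u where u: "u \<in> sphere 0 1"
    and le: "\<And>w. w \<in> sphere 0 1 \<Longrightarrow> norm (M *v u) \<le> norm (M *v w)"
    using continuous_attains_inf[of "sphere (0 :: real^'n) 1" "\<lambda>w. norm (M *v w)"]
      continuous_on_norm_matrix_vector[of _ M]
    by auto
  have bound: "norm (M *v u) * norm w \<le> norm (M *v w)" for w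
    using le[of "sgn w"] norm_matrix_vector_normalize[of M w]
    by (cases "w = 0") (simp_all add: norm_sgn mult_right_mono)
  have "(norm (M *v u))\<^sup>2 \<in> eigenvalues (transpose M ** M)"
  proof (rule gram_eigenvector_if_extremal[of 1 _ _ u])
    show "0 \<le> 1 * ((norm (M *v w))\<^sup>2 - (norm (M *v u))\<^sup>2 * (norm w)\<^sup>2)" for w
      using power_mono[OF bound[of w], of 2] by (simp add: power_mult_distrib)
  qed (use u in auto)
  hence "norm (M *v u) \<in> singular_values M"
    unfolding singular_values_def by (force intro: image_eqI)
  hence "sigma_min M \<le> norm (M *v u)"
    unfolding sigma_min_def
    by (intro Min_le) (simp_all add: singular_values_def finite_eigenvalues_gram)
  thus ?thesis using bound[of v] mult_right_mono order_trans norm_ge_zero by metis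
qed

lemma norm_le_sigma_max_mult:
  fixes M :: "real^'n^'n"
  shows "norm (M *v v) \<le> sigma_max M * norm v"
proof -
  obtain u where u: "u \<in> sphere 0 1"
    and le: "\<And>w. w \<in> sphere 0 1 \<Longrightarrow> norm (M *v w) \<le> norm (M *v u)"
    using continuous_attains_sup[of "sphere (0 :: real^'n) 1" "\<lambda>w. norm (M *v w)"]
      continuous_on_norm_matrix_vector[of _ M]
    by auto
  have bound: "norm (M *v w) \<le> norm (M *v u) * norm w" for w
    using le[of "sgn w"] norm_matrix_vector_normalize[of M w]
    by (cases "w = 0") (simp_all add: norm_sgn mult_right_mono)
  have "(norm (M *v u))\<^sup>2 \<in> eigenvalues (transpose M ** M)"
  proof (rule gram_eigenvector_if_extremal[of "-1" _ _ u])
    show "0 \<le> -1 * ((norm (M *v w))\<^sup>2 - (norm (M *v u))\<^sup>2 * (norm w)\<^sup>2)" for w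
      using power_mono[OF bound[of w], of 2] by (simp add: power_mult_distrib)
  qed (use u in auto)
  hence "norm (M *v u) \<in> singular_values M"
    unfolding singular_values_def by (force intro: image_eqI)
  hence "norm (M *v u) \<le> sigma_max M"
    unfolding sigma_max_def
    by (intro Max_ge) (simp_all add: singular_values_def finite_eigenvalues_gram)
  thus ?thesis using bound[of v] mult_right_mono order_trans norm_ge_zero by metis
qed

section \<open>The residual after one Anderson step\<close>

lemma residual_affine_step:
  fixes M :: "real^'n^'n"
  assumes q_def: "q = (\<lambda>z. M *v z + b)"
  shows "residual q (q z) = M *v residual q z"
  by (simp add: q_def residual_def matrix_vector_right_distrib matrix_vector_mult_diff_distrib)

text \<open>The weights \<open>1 + \<beta>\<close> and \<open>-\<beta>\<close> sum to one, so the constant part of the residual is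
  preserved.\<close>

lemma residual_affine_combination:
  fixes M :: "real^'n^'n"
  assumes q_def: "q = (\<lambda>z. M *v z + b)"
  shows "residual q ((1 + \<beta>) *\<^sub>R v - \<beta> *\<^sub>R w)
    = (1 + \<beta>) *\<^sub>R residual q v - \<beta> *\<^sub>R residual q w"
  by (simp add: q_def residual_def matrix_vector_mult_diff_distrib matrix_vector_mult_scaleR
      algebra_simps)

lemma residual_aa1_step:
  fixes M :: "real^'n^'n" and x0 :: "real^'n"
  assumes q_def: "q = (\<lambda>z. M *v z + b)"
    and r_def: "r = (\<lambda>j. residual q (aa1 q x0 j))"
  shows "r (Suc (Suc j)) = M *v (r (Suc j)
    + aa1_beta q (aa1 q x0 (Suc j)) (aa1 q x0 j) *\<^sub>R (r (Suc j) - r j))"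
  unfolding r_def aa1.simps residual_affine_combination[OF q_def] residual_affine_step[OF q_def]
  by (simp add:
      matrix_vector_right_distrib matrix_vector_mult_diff_distrib matrix_vector_mult_scaleR
      scaleR_add_left scaleR_diff_right)

section \<open>The distance from the origin to the line through two residuals\<close>

lemma aa1_B_in_unit_interval:
  assumes "(\<psi>, t) \<in> aa1_B_domain"
  shows "aa1_B \<psi> t \<in> {0..1}"
proof -
  have pos: "0 < t\<^sup>2 - 2 * t * cos \<psi> + 1"
    using assms by (rule aa1_B_denominator_pos)
  have "t\<^sup>2 - 2 * t * cos \<psi> + 1 = (t - cos \<psi>)\<^sup>2 + (sin \<psi>)\<^sup>2"
    using sin_cos_squared_add[of \<psi>] by (simp add: power2_eq_square algebra_simps)
  hence "(sin \<psi>)\<^sup>2 \<le> t\<^sup>2 - 2 * t * cos \<psi> + 1" by simp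
  thus ?thesis using pos by (simp add: aa1_B_def)
qed

lemma law_of_cosines_ratio:
  fixes u v :: "'a::real_inner"
  assumes v: "v \<noteq> 0"
    and angle: "u \<bullet> v = norm v * norm u * cos \<phi>"
    and y: "y = norm u / norm v"
  shows "(norm (u - v))\<^sup>2 = (norm v)\<^sup>2 * (y\<^sup>2 - 2 * y * cos \<phi> + 1)"
proof -
  have nu: "norm u = y * norm v" using v y by simp
  have "(norm (u - v))\<^sup>2 = (norm u)\<^sup>2 - 2 * (u \<bullet> v) + (norm v)\<^sup>2"
    by (simp add: power2_norm_eq_inner inner_diff_left inner_diff_right inner_commute)
  thus ?thesis unfolding angle nu by (simp add: power2_eq_square algebra_simps)
qed

text \<open>Pythagoras gives \<open>\<parallel>p\<parallel>\<^sup>2 \<parallel>d\<parallel>\<^sup>2 = \<parallel>u\<parallel>\<^sup>2 \<parallel>d\<parallel>\<^sup>2 - (u \<bullet> d)\<^sup>2\<close> for the component \<open>p\<close> of \<open>u\<close>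
  orthogonal to \<open>d = u - v\<close>. The right-hand side is a Gram determinant, which does not change when
  \<open>d\<close> is replaced by \<open>v\<close>; it is then \<open>\<parallel>u\<parallel>\<^sup>2 \<parallel>v\<parallel>\<^sup>2 sin\<^sup>2 \<phi>\<close>, the squared area of the
  parallelogram spanned by \<open>u\<close> and \<open>v\<close>.\<close>

lemma norm_rejection_eq_aa1_B:
  fixes u v :: "'a::real_inner"
  assumes v: "v \<noteq> 0" and uv: "u \<noteq> v"
    and angle: "u \<bullet> v = norm v * norm u * cos \<phi>"
    and y: "y = norm u / norm v"
  shows "norm (u + (- (u \<bullet> (u - v)) / (norm (u - v))\<^sup>2) *\<^sub>R (u - v)) = sqrt (aa1_B \<phi> y) * norm u"
proof -
  define d where "d = u - v"
  define D where "D = (norm d)\<^sup>2"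
  define p where "p = u + (- (u \<bullet> d) / D) *\<^sub>R d"
  have D: "D > 0" using uv by (simp add: D_def d_def)
  have dd: "d \<bullet> d = D" by (simp add: D_def power2_norm_eq_inner)
  define E where "E = y\<^sup>2 - 2 * y * cos \<phi> + 1"
  have D_eq: "D = (norm v)\<^sup>2 * E"
    unfolding D_def d_def E_def using v angle y by (rule law_of_cosines_ratio)
  have "(norm p)\<^sup>2 = u \<bullet> u - (u \<bullet> d)\<^sup>2 / D"
    using D unfolding p_def power2_norm_eq_inner inner_add_left inner_add_right
    by (simp add: inner_commute[of d u] dd power2_eq_square)
  hence "(norm p)\<^sup>2 * D = (u \<bullet> u) * (d \<bullet> d) - (u \<bullet> d)\<^sup>2"
    using D by (simp add: dd field_simps)
  also have "\<dots> = (u \<bullet> u) * (v \<bullet> v) - (u \<bullet> v)\<^sup>2"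
    by (simp add: d_def inner_diff_left inner_diff_right inner_commute[of v u] power2_eq_square
        algebra_simps)
  also have "\<dots> = (norm u)\<^sup>2 * (norm v)\<^sup>2 * (1 - (cos \<phi>)\<^sup>2)"
    unfolding angle by (simp add: power2_norm_eq_inner[symmetric] power_mult_distrib algebra_simps)
  also have "\<dots> = (norm u)\<^sup>2 * (norm v)\<^sup>2 * (sin \<phi>)\<^sup>2"
    by (simp add: sin_squared_eq)
  finally have "(norm v)\<^sup>2 * ((norm p)\<^sup>2 * E) = (norm v)\<^sup>2 * ((sin \<phi>)\<^sup>2 * (norm u)\<^sup>2)"
    unfolding D_eq by (simp add: ac_simps)
  hence "(norm p)\<^sup>2 * E = (sin \<phi>)\<^sup>2 * (norm u)\<^sup>2"
    using v by simp
  moreover have "E \<noteq> 0" using D D_eq by auto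
  ultimately have "(norm p)\<^sup>2 = aa1_B \<phi> y * (norm u)\<^sup>2"
    by (simp add: aa1_B_def E_def[symmetric] eq_divide_eq)
  hence "norm p = sqrt (aa1_B \<phi> y * (norm u)\<^sup>2)"
    by (metis norm_ge_zero real_sqrt_unique)
  thus ?thesis by (simp add: p_def d_def D_def real_sqrt_mult)
qed

section \<open>The convergence factor of Anderson acceleration with depth one\<close>

theorem theorem3p7:
  fixes M :: "real^'n^'n" and b x0 :: "real^'n"
    and q :: "real^'n \<Rightarrow> real^'n" and x r :: "nat \<Rightarrow> real^'n"
    and k :: nat and y \<phi> :: real
  assumes q_def: "q = (\<lambda>z. M *v z + b)"
    and nonsing: "invertible (mat 1 - M)"
    and M_nonzero: "M \<noteq> 0"
    and x_def: "x = aa1 q x0"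
    and r_def: "r = (\<lambda>j. residual q (x j))"
    and k: "k > 1"
    and r_prev: "r (k - 1) \<noteq> 0"
    and r_cur: "r k \<noteq> 0"
    and y_def: "y = norm (r k) / norm (r (k - 1))"
    and phi_range: "\<phi> \<in> {0..pi}"
    and phi_angle: "r k \<bullet> r (k - 1) = norm (r (k - 1)) * norm (r k) * cos \<phi>"
  shows "(\<forall>(\<psi>, t) \<in> aa1_B_domain. aa1_B \<psi> t \<in> {0..1})
    \<and> y > 0
    \<and> (r k \<noteq> r (k - 1) \<longrightarrow>
        (\<phi>, y) \<in> aa1_B_domain
        \<and> sqrt (aa1_B \<phi> y) * sigma_min M \<le> norm (r (k + 1)) / norm (r k)
        \<and> norm (r (k + 1)) / norm (r k) \<le> sqrt (aa1_B \<phi> y) * sigma_max M)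
    \<and> (r k = r (k - 1) \<longrightarrow>
        sigma_min M \<le> norm (r (k + 1)) / norm (r k)
        \<and> norm (r (k + 1)) / norm (r k) \<le> sigma_max M)"
proof -
  obtain j where kj: "k = Suc j" using k by (cases k) auto
  define u v where "u = r k" and "v = r (k - 1)"
  define \<beta> where "\<beta> = aa1_beta q (x k) (x (k - 1))"
  define p where "p = u + \<beta> *\<^sub>R (u - v)"
  have nz: "u \<noteq> 0" "v \<noteq> 0" using r_cur r_prev by (simp_all add: u_def v_def)
  have angle: "u \<bullet> v = norm v * norm u * cos \<phi>" and y: "y = norm u / norm v"
    using phi_angle y_def by (simp_all add: u_def v_def)
  have ypos: "y > 0" using nz y by simp
  have "r (k + 1) = M *v p"
    using residual_aa1_step[OF q_def, of r x0 j] r_def x_def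
    by (simp add: kj p_def u_def v_def \<beta>_def)
  hence lower: "sigma_min M * norm p \<le> norm (r (k + 1))"
    and upper: "norm (r (k + 1)) \<le> sigma_max M * norm p"
    by (simp_all add: sigma_min_mult_norm_le norm_le_sigma_max_mult)
  have beta: "\<beta> = (if u \<noteq> v then - (u \<bullet> (u - v)) / (norm (u - v))\<^sup>2 else 0)"
    by (simp add: \<beta>_def aa1_beta_def u_def v_def r_def)
  have ratio: "s * sigma_min M \<le> norm (r (k + 1)) / norm u
      \<and> norm (r (k + 1)) / norm u \<le> s * sigma_max M" if "norm p = s * norm u" for s
    using lower upper nz(1) unfolding that by (simp add: field_simps)
  have dom: "(\<phi>, y) \<in> aa1_B_domain" if "u \<noteq> v"
  proof -
    have "(\<phi>, y) \<noteq> (0, 1)"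
      using law_of_cosines_ratio[OF nz(2) angle y] that by auto
    thus ?thesis using phi_range ypos by (auto simp: aa1_B_domain_def)
  qed
  have "norm p = sqrt (aa1_B \<phi> y) * norm u" if "u \<noteq> v"
    using norm_rejection_eq_aa1_B[OF nz(2) that angle y] that by (simp add: p_def beta)
  moreover have "norm p = 1 * norm u" if "u = v"
    using that by (simp add: p_def)
  ultimately show ?thesis
    unfolding u_def[symmetric] v_def[symmetric]
    using aa1_B_in_unit_interval ypos dom ratio[of "sqrt (aa1_B \<phi> y)"] ratio[of 1]
    by auto
qed

end
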